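(* Let $L$ be a countable bounded distributive lattice. Then $L$ is not a Heyting algebra if and only if there is $i\in\{1,2,3\}$ such that $L_i$ is a homomorphic image of $L$ via an onto bounded lattice homomorphism $h_i\colon L\to L_i$ with the following property: there are $a,b\in L$ such that $h_i[I_{a\to b}]=I_{c_i\to 0}$, where $c_1=c$, $c_2=\{0\}$, and $c_3=(\varnothing,1)$.
   Context: A bounded distributive lattice $L$ is a Heyting algebra if for all $a,b\in L$ there is an element $a\to b\in L$ such that for all $x\in L$: $a\wedge x\le b$ iff $x\le a\to b$. "Countable" includes finite. For a bounded distributive lattice $L$ and $a,b\in L$, define the ideal $I_{a\to b}:=\{d\in L\mid d\wedge a\le b\}$. In $I_{c_i\to 0}$, this is computed in $L_i$, with $0$ the bottom of $L_i$. $h_i[I_{a\to b}]$ denotes the direct image. The lattices $L_1,L_2,L_3$ and the elements $c_i\in L_i$ are as follows. - $L_1$: let $Z_1=\{x,y\}\cup\{z_n\mid n\in\omega\}$ be the one-point compactification of the countable discrete space $\{y\}\cup\{z_n\mid n\in\omega\}$, with $x$ the added point, partially ordered by $x<y$, $z_0>z_1>z_2>\cdots$, $x<z_n$ for all $n$, and no other strict relations. $L_1$ is the lattice (under inclusion) of clopen upsets of $Z_1$; explicitly its elements are $\varnothing$, $\{y\}$, ${\uparrow}z_n=\{z_0,\dots,z_n\}$, ${\uparrow}z_n\cup\{y\}$ ($n\in\omega$), and $Z_1$. The element $c\in L_1$ is $\{y\}$. - $L_2$: the lattice $\mathcal{P}_{\rm fin}(\omega)$ of finite subsets of $\omega$ ordered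 by inclusion, together with an added top element. Here $c_2=\{0\}\in\mathcal{P}_{\rm fin}(\omega)$ is the singleton of the number $0\in\omega$. - $L_3$: let ${\bf CF}(\omega)$ be the Boolean algebra of finite and cofinite subsets of $\omega$ and ${\bf 2}=\{0,1\}$ the two-element Boolean algebra. $L_3$ is the bounded sublattice of ${\bf CF}(\omega)\times{\bf 2}$ consisting of the pairs $(A,n)$ such that $A$ is finite or $n=1$. Here $c_3=(\varnothing,1)$. *)

theory Defs
  imports "HOL-Analysis.Analysis" "HOL-Library.FSet" "HOL-Library.Lattice_Constructions"
    "HOL-Library.Product_Order"
begin

section \<open>Heyting algebras, bounded lattice homomorphisms and the ideals \<open>I\<^bsub>a\<rightarrow>b\<^esub>\<close>\<close>

definition heyting_algebra :: "'a::{distrib_lattice, bounded_lattice} itself \<Rightarrow> bool" where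
  "heyting_algebra (_ :: 'a itself) \<longleftrightarrow>
     (\<forall>a b :: 'a. \<exists>c. \<forall>x. inf a x \<le> b \<longleftrightarrow> x \<le> c)"

definition bounded_lattice_hom :: "('a::bounded_lattice \<Rightarrow> 'b::bounded_lattice) \<Rightarrow> bool" where
  "bounded_lattice_hom h \<longleftrightarrow>
     (\<forall>x y. h (inf x y) = inf (h x) (h y)) \<and>
     (\<forall>x y. h (sup x y) = sup (h x) (h y)) \<and>
     h bot = bot \<and> h top = top"

definition impl_ideal :: "'a::lattice \<Rightarrow> 'a \<Rightarrow> 'a set" where
  "impl_ideal a b = {d. inf d a \<le> b}"


section \<open>The lattice \<open>L\<^sub>1\<close>\<close>

datatype Z1_discrete = y_pt | z_pt nat

text \<open>The point \<open>x\<close> added by the compactification is \<^term>\<open>None\<close>.\<close>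

type_synonym Z1 = "Z1_discrete option"

definition Z1_topology :: "Z1 topology" where
  "Z1_topology = Alexandroff_compactification (discrete_topology UNIV)"

fun Z1_le :: "Z1 \<Rightarrow> Z1 \<Rightarrow> bool" where
  "Z1_le None q \<longleftrightarrow> True"
| "Z1_le (Some y_pt) q \<longleftrightarrow> q = Some y_pt"
| "Z1_le (Some (z_pt n)) q \<longleftrightarrow> (\<exists>m. n \<ge> m \<and> q = Some (z_pt m))"

lemma Z1_le_refl: "Z1_le p p"
  by (cases "(p, p)" rule: Z1_le.cases) auto

lemma Z1_le_trans: "Z1_le p q \<Longrightarrow> Z1_le q r \<Longrightarrow> Z1_le p r"
  by (cases "(p, q)" rule: Z1_le.cases; cases "(q, r)" rule: Z1_le.cases) auto

lemma Z1_le_antisym: "Z1_le p q \<Longrightarrow> Z1_le q p \<Longrightarrow> p = q"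
  by (cases "(p, q)" rule: Z1_le.cases; cases "(q, p)" rule: Z1_le.cases) auto

definition Z1_upset :: "Z1 set \<Rightarrow> bool" where
  "Z1_upset U \<longleftrightarrow> (\<forall>p\<in>U. \<forall>q. Z1_le p q \<longrightarrow> q \<in> U)"

lemma topspace_Z1: "topspace Z1_topology = UNIV"
  by (simp add: Z1_topology_def UNIV_option_conv)

typedef L1 = "{U. openin Z1_topology U \<and> closedin Z1_topology U \<and> Z1_upset U}"
  by (rule exI[of _ "{}"]) (simp add: Z1_upset_def)

setup_lifting type_definition_L1

instantiation L1 :: "{distrib_lattice, bounded_lattice}"
begin

lift_definition less_eq_L1 :: "L1 \<Rightarrow> L1 \<Rightarrow> bool" is "(\<subseteq>)" .
lift_definition less_L1 :: "L1 \<Rightarrow> L1 \<Rightarrow> bool" is "(\<subset>)" .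
lift_definition inf_L1 :: "L1 \<Rightarrow> L1 \<Rightarrow> L1" is "(\<inter>)"
  by (auto simp: Z1_upset_def)
lift_definition sup_L1 :: "L1 \<Rightarrow> L1 \<Rightarrow> L1" is "(\<union>)"
  by (auto simp: Z1_upset_def)
lift_definition bot_L1 :: L1 is "{}"
  by (simp add: Z1_upset_def)
lift_definition top_L1 :: L1 is UNIV
  by (metis (mono_tags, lifting) Z1_upset_def UNIV_I closedin_topspace openin_topspace topspace_Z1)

instance
  by standard (transfer; blast)+

end

lemma openin_Z1: "openin Z1_topology U \<longleftrightarrow> None \<notin> U \<or> finite (- U)"
proof -
  have "openin Z1_topology U \<longleftrightarrow>
      (\<exists>V. U = Some ` V) \<or> (\<exists>C. finite C \<and> U = insert None (Some ` (- C)))"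
    by (simp add: Z1_topology_def openin_Alexandroff_compactification compactin_discrete_topology
        Compl_eq_Diff_UNIV)
  also have "(\<exists>V. U = Some ` V) \<longleftrightarrow> None \<notin> U"
  proof
    assume "None \<notin> U"
    then have "U = Some ` (Some -` U)"
      by (metis (no_types, opaque_lifting) image_vimage_eq inf.absorb_iff1 notin_range_Some subsetI)
    then show "\<exists>V. U = Some ` V" ..
  qed auto
  also have "(\<exists>C. finite C \<and> U = insert None (Some ` (- C))) \<longleftrightarrow> None \<in> U \<and> finite (- U)"
  proof
    assume "\<exists>C. finite C \<and> U = insert None (Some ` (- C))"
    then obtain C where C: "finite C" "U = insert None (Some ` (- C))" by blast
    have "- U \<subseteq> Some ` C"
    proof
      fix p assume "p \<in> - U" then show "p \<in> Some ` C" using C by (cases p) auto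
    qed
    then show "None \<in> U \<and> finite (- U)" using C by (auto intro: finite_subset)
  next
    assume A: "None \<in> U \<and> finite (- U)"
    have "finite (Some -` (- U))" using A by (intro finite_vimageI) auto
    moreover have "U = insert None (Some ` (- (Some -` (- U))))"
    proof (rule set_eqI)
      fix p show "p \<in> U \<longleftrightarrow> p \<in> insert None (Some ` (- (Some -` (- U))))"
        using A by (cases p) auto
    qed
    ultimately show "\<exists>C. finite C \<and> U = insert None (Some ` (- C))" by blast
  qed
  finally show ?thesis by blast
qed

lemma Z1_clopen_upsets:
  "{U. openin Z1_topology U \<and> closedin Z1_topology U \<and> Z1_upset U} =
     {{}, {Some y_pt}, UNIV} \<union>
     range (\<lambda>n. (Some \<circ> z_pt) ` {..n}) \<union>
     range (\<lambda>n. insert (Some y_pt) ((Some \<circ> z_pt) ` {..n}))"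
  (is "?L = ?R")
proof
  have clo: "closedin Z1_topology U \<longleftrightarrow> None \<in> U \<or> finite U" for U
    using openin_Z1[of "- U"]
    by (simp add: closedin_def topspace_Z1 Compl_eq_Diff_UNIV Diff_Diff_Int)
  show "?R \<subseteq> ?L"
    by (auto simp: clo openin_Z1 Z1_upset_def)
  show "?L \<subseteq> ?R"
  proof
    fix U assume "U \<in> ?L"
    then have U: "None \<in> U \<or> finite U" "Z1_upset U" by (auto simp: clo)
    show "U \<in> ?R"
    proof (cases "None \<in> U")
      case True
      then have "U = UNIV" using U(2) by (auto simp: Z1_upset_def)
      then show ?thesis by simp
    next
      case False
      define N where "N = {n. Some (z_pt n) \<in> U}"
      have fin: "finite N"
      proof -
        have "N = (Some \<circ> z_pt) -` U" by (auto simp: N_def)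
        moreover have "inj (Some \<circ> z_pt)" by (auto simp: inj_def)
        ultimately show ?thesis using U(1) False by (simp add: finite_vimageI)
      qed
      have dn: "m \<in> N" if "n \<in> N" "m \<le> n" for m n
        using that U(2) unfolding N_def Z1_upset_def by fastforce
      have N: "N = {} \<or> (\<exists>n. N = {..n})"
      proof (cases "N = {}")
        case False
        have "n \<in> N \<longleftrightarrow> n \<le> Max N" for n
          using Max_ge[OF fin] dn[OF Max_in[OF fin False]] by blast
        then have "N = {..Max N}" by blast
        then show ?thesis by blast
      qed simp
      have eq: "U = (if Some y_pt \<in> U then {Some y_pt} else {}) \<union> (Some \<circ> z_pt) ` N"
      proof (rule set_eqI)
        fix p
        show "p \<in> U \<longleftrightarrow>
            p \<in> (if Some y_pt \<in> U then {Some y_pt} else {}) \<union> (Some \<circ> z_pt) ` N"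
          using False by (cases "(p, p)" rule: Z1_le.cases) (auto simp: N_def)
      qed
      have "(if Some y_pt \<in> U then {Some y_pt} else {}) \<union> (Some \<circ> z_pt) ` N \<in> ?R"
        using N by (elim disjE exE) (simp_all)
      then show ?thesis unfolding eq[symmetric] .
    qed
  qed
qed

lift_definition c1 :: L1 is "{Some y_pt}"
  using Z1_clopen_upsets by blast


section \<open>The lattice \<open>L\<^sub>2\<close>\<close>

text \<open>The type constructor \<open>top\<close> adjoins a new top element \<open>top.Top\<close> to a lattice, whose
  old elements are embedded by \<open>top.Value\<close>.\<close>

instance top :: (bounded_lattice_bot) bounded_lattice
  by standard (auto simp: bot_top_def less_eq_top_def split: top.splits)

instance top :: (distrib_lattice) distrib_lattice
  by standard (auto simp: inf_top_def sup_top_def sup_inf_distrib1 split: top.splits)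

type_synonym L2 = "nat fset top"

definition c2 :: L2 where
  "c2 = top.Value {|0|}"


section \<open>The lattice \<open>L\<^sub>3\<close>\<close>

text \<open>The two-element Boolean algebra is \<^typ>\<open>bool\<close>; the order on pairs is componentwise.\<close>

definition CF :: "nat set set" where
  "CF = {A. finite A \<or> finite (- A)}"

typedef L3 = "{(A, n) \<in> CF \<times> (UNIV :: bool set). finite A \<or> n = True}"
  by (rule exI[of _ "({}, False)"]) (simp add: CF_def)

setup_lifting type_definition_L3

instantiation L3 :: "{distrib_lattice, bounded_lattice}"
begin

lift_definition less_eq_L3 :: "L3 \<Rightarrow> L3 \<Rightarrow> bool" is "(\<le>)" .
lift_definition less_L3 :: "L3 \<Rightarrow> L3 \<Rightarrow> bool" is "(<)" .
lift_definition inf_L3 :: "L3 \<Rightarrow> L3 \<Rightarrow> L3" is inf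
  by (auto simp: CF_def)
lift_definition sup_L3 :: "L3 \<Rightarrow> L3 \<Rightarrow> L3" is sup
  by (auto simp: CF_def)
lift_definition bot_L3 :: L3 is bot
  by (auto simp: CF_def bot_prod_def)
lift_definition top_L3 :: L3 is top
  by (auto simp: CF_def top_prod_def)

instance
  by standard (transfer; auto simp: less_le_not_le sup_inf_distrib1)+

end

lift_definition c3 :: L3 is "({}, True)"
  by (simp add: CF_def)

end

theory Submission
  imports Defs "HOL-Library.Ramsey" "HOL-Library.Diagonal_Subsequence"
begin

text \<open>
  Prime filters are treated as bounded lattice homomorphisms into \<^typ>\<open>bool\<close>. If
  \<open>I = I\<^bsub>a\<rightarrow>b\<^esub>\<close> has no greatest element, countability yields a strictly increasing cofinal
  sequence \<open>d\<^sub>n\<close> in \<open>I\<close>, and prime filters \<open>z\<^sub>n\<close> containing \<open>d\<^sub>n\<^sub>+\<^sub>1\<close> but not \<open>d\<^sub>n\<close>. A subsequence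
  converges pointwise to a prime filter \<open>x\<close>, which misses \<open>I\<close> and hence lies below a prime
  filter \<open>y\<close> that contains \<open>a\<close> but not \<open>b\<close>. The points \<open>x\<close>, \<open>y\<close>, \<open>z\<^sub>n\<close> form a closed subset of
  the Priestley space, and by Ramsey's theorem one may assume that the \<open>z\<^sub>n\<close> form either a descending
  chain (which gives \<open>L\<^sub>1\<close>) or an antichain; in the latter case \<open>x\<close> is below all \<open>z\<^sub>n\<close> (\<open>L\<^sub>2\<close>) or below
  none (\<open>L\<^sub>3\<close>). Conversely, a greatest element of \<open>I\<^bsub>a\<rightarrow>b\<^esub>\<close> would be mapped to a greatest element of
  \<open>I\<^bsub>c\<^sub>i\<rightarrow>0\<^esub>\<close>, and there is none.
\<close>

section \<open>Prime filters\<close>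

lemma bounded_lattice_homD:
  assumes "bounded_lattice_hom h"
  shows "h (inf u v) = inf (h u) (h v)" "h (sup u v) = sup (h u) (h v)" "h bot = bot" "h top = top"
  using assms unfolding bounded_lattice_hom_def by blast+

lemma bounded_lattice_hom_mono:
  assumes "bounded_lattice_hom h" "u \<le> v"
  shows "h u \<le> h v"
  using assms by (metis bounded_lattice_homD(1) inf.absorb_iff2 inf.commute)

text \<open>Prime filters are encoded as homomorphisms into \<open>bool\<close>; plain filters serve
  only to construct them. The improper filter is allowed, so adjoining an element always gives a
  filter.\<close>

definition lattice_filter :: "'a::bounded_lattice set \<Rightarrow> bool" where
  "lattice_filter F \<longleftrightarrow> top \<in> F \<and> (\<forall>u\<in>F. \<forall>v\<in>F. inf u v \<in> F) \<and> (\<forall>u\<in>F. \<forall>v. u \<le> v \<longrightarrow> v \<in> F)"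

lemma lattice_filterD:
  assumes "lattice_filter F"
  shows "top \<in> F" "u \<in> F \<Longrightarrow> v \<in> F \<Longrightarrow> inf u v \<in> F" "u \<in> F \<Longrightarrow> u \<le> v \<Longrightarrow> v \<in> F"
  using assms unfolding lattice_filter_def by blast+

text \<open>The filter generated by \<open>F\<close> and \<open>u\<close>. It serves twice: to
  exploit maximality after Zorn's lemma, and to put \<open>a\<close> into the filter that becomes
  \<open>y\<close>.\<close>

lemma lattice_filter_adjoin:
  fixes F :: "'a::bounded_lattice set"
  assumes "lattice_filter F"
  shows "lattice_filter {w. \<exists>f\<in>F. inf f u \<le> w}"
  unfolding lattice_filter_def
proof (intro conjI ballI allI impI)
  show "top \<in> {w. \<exists>f\<in>F. inf f u \<le> w}"
    using lattice_filterD(1)[OF assms] by auto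
next
  fix v w assume "v \<in> {w. \<exists>f\<in>F. inf f u \<le> w}" "w \<in> {w. \<exists>f\<in>F. inf f u \<le> w}"
  then obtain f g where fg: "f \<in> F" "g \<in> F" "inf f u \<le> v" "inf g u \<le> w" by auto
  have "inf (inf f g) u \<le> inf f u" "inf (inf f g) u \<le> inf g u"
    by (auto intro: le_infI1)
  then have "inf (inf f g) u \<le> inf v w"
    using fg by (meson le_inf_iff order_trans)
  then show "inf v w \<in> {w. \<exists>f\<in>F. inf f u \<le> w}"
    using fg lattice_filterD(2)[OF assms] by blast
next
  fix v w assume "v \<in> {w. \<exists>f\<in>F. inf f u \<le> w}" "v \<le> w"
  then show "w \<in> {w. \<exists>f\<in>F. inf f u \<le> w}"
    by (auto intro: order_trans)
qed

text \<open>A filter maximal among those that contain \<open>F\<close> and omit \<open>b\<close> is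
  prime: if \<open>u\<close> and \<open>v\<close> lie outside it, adjoining either one forces
  \<open>b\<close> in, and by distributivity so would \<open>sup u v\<close>.\<close>

lemma prime_filter_extension:
  fixes F :: "'a::{distrib_lattice, bounded_lattice} set"
  assumes F: "lattice_filter F" and b: "b \<notin> F"
  obtains p where "bounded_lattice_hom p" "\<And>u. u \<in> F \<Longrightarrow> p u" "\<not> p b"
proof -
  define \<A> where "\<A> = {G. lattice_filter G \<and> F \<subseteq> G \<and> b \<notin> G}"
  have "\<exists>M\<in>\<A>. \<forall>G\<in>\<A>. M \<subseteq> G \<longrightarrow> G = M"
  proof (rule subset_Zorn_nonempty)
    show "\<A> \<noteq> {}" using F b by (auto simp: \<A>_def)
  next
    fix C assume C: "C \<noteq> {}" "subset.chain \<A> C"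
    then have sub: "C \<subseteq> \<A>" and lin: "\<And>G H. G \<in> C \<Longrightarrow> H \<in> C \<Longrightarrow> G \<subseteq> H \<or> H \<subseteq> G"
      by (auto simp: subset_chain_def)
    have fil: "\<And>G. G \<in> C \<Longrightarrow> lattice_filter G" using sub by (auto simp: \<A>_def)
    have "lattice_filter (\<Union>C)"
      unfolding lattice_filter_def
    proof (intro conjI ballI allI impI)
      show "top \<in> \<Union>C" using C(1) fil lattice_filterD(1) by blast
    next
      fix u v assume "u \<in> \<Union>C" "v \<in> \<Union>C"
      then obtain G where "G \<in> C" "u \<in> G" "v \<in> G" using lin by blast
      then show "inf u v \<in> \<Union>C" using fil lattice_filterD(2) by blast
    next
      fix u v assume "u \<in> \<Union>C" "u \<le> v"
      then show "v \<in> \<Union>C" using fil lattice_filterD(3) by blast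
    qed
    then show "\<Union>C \<in> \<A>" using C(1) sub by (auto simp: \<A>_def)
  qed
  then obtain M where "M \<in> \<A>" and M_max: "\<forall>G\<in>\<A>. M \<subseteq> G \<longrightarrow> G = M" ..
  then have M: "lattice_filter M" "F \<subseteq> M" "b \<notin> M" by (auto simp: \<A>_def)
  have max: "G = M" if "lattice_filter G" "M \<subseteq> G" "b \<notin> G" for G
    using M_max M(2) that unfolding \<A>_def by blast
  note MD = lattice_filterD[OF M(1)]
  have adjoin: "\<exists>f\<in>M. inf f u \<le> b" if "u \<notin> M" for u
  proof (rule ccontr)
    let ?G = "{w. \<exists>f\<in>M. inf f u \<le> w}"
    assume "\<not> ?thesis"
    then have "?G = M"
    proof (intro max lattice_filter_adjoin M(1))
      show "M \<subseteq> ?G" using inf_le1 by blast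
    qed simp
    moreover have "u \<in> ?G" using MD(1) by auto
    ultimately show False using that by simp
  qed
  have prime: "u \<in> M \<or> v \<in> M" if s: "sup u v \<in> M" for u v
  proof (rule ccontr)
    assume "\<not> ?thesis"
    then obtain f g where fg: "f \<in> M" "g \<in> M" "inf f u \<le> b" "inf g v \<le> b"
      using adjoin by blast
    have "inf (inf f g) u \<le> b" "inf (inf f g) v \<le> b"
      by (rule order_trans[OF inf_mono[OF inf_le1 order_refl] fg(3)],
          rule order_trans[OF inf_mono[OF inf_le2 order_refl] fg(4)])
    then have "inf (inf f g) (sup u v) \<le> b"
      by (simp add: inf_sup_distrib1)
    moreover have "inf (inf f g) (sup u v) \<in> M" using MD(2) fg s by blast
    ultimately show False using MD(3) M(3) by blast
  qed
  have "bot \<notin> M" using MD(3) M(3) by (metis bot_least)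
  then have "bounded_lattice_hom (\<lambda>u. u \<in> M)"
    unfolding bounded_lattice_hom_def
    by (auto simp: MD(1) dest: prime intro: MD(2) MD(3) sup_ge1 sup_ge2 inf_le1 inf_le2)
  then show ?thesis using that M by blast
qed

lemma prime_filter_separates:
  fixes u v :: "'a::{distrib_lattice, bounded_lattice}"
  assumes "\<not> u \<le> v"
  obtains p where "bounded_lattice_hom p" "p u" "\<not> p v"
proof -
  have "lattice_filter {w. u \<le> w}" by (auto simp: lattice_filter_def)
  then show ?thesis using prime_filter_extension[of _ v] assms that by (metis mem_Collect_eq order_refl)
qed

text \<open>The order on maps into \<open>bool\<close> is inclusion of filters. For one
  \<open>p\<close>, a finite meet over \<open>q\<close> of elements of \<open>p\<close> outside
  \<open>q\<close> stays in \<open>p\<close>; the finite join of these meets over all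
  \<open>p\<close> stays outside every \<open>q\<close> by primeness.\<close>

lemma finite_prime_filters_separated:
  fixes A B :: "('a::bounded_lattice \<Rightarrow> bool) set"
  assumes fin: "finite A" "finite B"
    and A: "\<And>p. p \<in> A \<Longrightarrow> bounded_lattice_hom p" and B: "\<And>q. q \<in> B \<Longrightarrow> bounded_lattice_hom q"
    and nle: "\<And>p q. p \<in> A \<Longrightarrow> q \<in> B \<Longrightarrow> \<not> p \<le> q"
  shows "\<exists>v. (\<forall>p\<in>A. p v) \<and> (\<forall>q\<in>B. \<not> q v)"
proof -
  have one: "\<exists>v. p v \<and> (\<forall>q\<in>B. \<not> q v)" if "p \<in> A" for p
    using fin(2) B nle[OF that]
  proof (induction B)
    case empty
    have "p top" using A[OF that] by (simp add: bounded_lattice_homD)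
    then show ?case by blast
  next
    case (insert q B)
    then obtain v where v: "p v" "\<forall>q\<in>B. \<not> q v" by auto
    obtain w where w: "p w" "\<not> q w" using insert.prems(2)[of q] by auto
    have "p (inf v w)" using v w A[OF that] by (simp add: bounded_lattice_homD)
    moreover have "\<not> r (inf v w)" if "r \<in> insert q B" for r
      using v w that insert.prems(1)[OF that] by (auto simp: bounded_lattice_homD)
    ultimately show ?case by blast
  qed
  show ?thesis
    using fin(1) A one
  proof (induction A)
    case empty
    have "\<forall>q\<in>B. \<not> q bot" using B by (simp add: bounded_lattice_homD)
    then show ?case by blast
  next
    case (insert p A)
    then obtain v where v: "\<forall>p\<in>A. p v" "\<forall>q\<in>B. \<not> q v" by auto
    obtain w where w: "p w" "\<forall>q\<in>B. \<not> q w" using insert.prems(2)[of p] by auto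
    have "r (sup v w)" if "r \<in> insert p A" for r
      using v w that insert.prems(1)[OF that] by (auto simp: bounded_lattice_homD)
    moreover have "\<forall>q\<in>B. \<not> q (sup v w)" using v w B by (auto simp: bounded_lattice_homD)
    ultimately show ?case by blast
  qed
qed

section \<open>Subsequences and pointwise limits\<close>

lemma infinite_set_subseq:
  fixes N :: "nat set"
  assumes "infinite N"
  obtains \<sigma> :: "nat \<Rightarrow> nat" where "strict_mono \<sigma>" "\<And>n. \<sigma> n \<in> N"
  using that[OF strict_mono_enumerate[OF assms] enumerate_in_set[OF assms]] .

lemma constant_subseq:
  fixes P :: "nat \<Rightarrow> bool"
  obtains \<sigma> :: "nat \<Rightarrow> nat" and c where "strict_mono \<sigma>" "\<And>n. P (\<sigma> n) \<longleftrightarrow> c"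
proof (cases "finite {n. P n}")
  case True
  then have "infinite {n. \<not> P n}" by (simp add: infinite_UNIV_nat)
  then obtain \<sigma> :: "nat \<Rightarrow> nat" where "strict_mono \<sigma>" "\<And>n. \<sigma> n \<in> {n. \<not> P n}"
    by (rule infinite_set_subseq) blast
  then show ?thesis using that[of \<sigma> False] by simp
next
  case False
  then obtain \<sigma> :: "nat \<Rightarrow> nat" where "strict_mono \<sigma>" "\<And>n. \<sigma> n \<in> {n. P n}"
    by (rule infinite_set_subseq) blast
  then show ?thesis using that[of \<sigma> True] by simp
qed

text \<open>Sequential compactness of the space of \<open>bool\<close>-valued maps on a countable
  set, by a diagonal argument over an enumeration \<open>e\<close>.\<close>

lemma pointwise_convergent_subseq:
  fixes z :: "nat \<Rightarrow> 'a \<Rightarrow> bool"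
  assumes "countable (UNIV :: 'a set)"
  obtains \<sigma> :: "nat \<Rightarrow> nat" and x where "strict_mono \<sigma>" "\<And>v. \<forall>\<^sub>F n in sequentially. z (\<sigma> n) v = x v"
proof -
  define e where "e = from_nat_into (UNIV :: 'a set)"
  define P where "P k s \<longleftrightarrow> (\<exists>c. \<forall>\<^sub>F n in sequentially. z (s n) (e k) = c)" for k and s :: "nat \<Rightarrow> nat"
  interpret subseqs P
  proof
    fix k and s :: "nat \<Rightarrow> nat"
    assume "strict_mono s"
    obtain r :: "nat \<Rightarrow> nat" and c where "strict_mono r" "\<And>n. z (s (r n)) (e k) \<longleftrightarrow> c"
      by (rule constant_subseq[of "\<lambda>n. z (s n) (e k)"]) blast
    then show "\<exists>r. strict_mono r \<and> P k (s \<circ> r)" by (auto simp: P_def intro!: exI[of _ r] exI[of _ c])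
  qed
  \<comment> \<open>The diagonal sequence refines the stage that settles \<open>e k\<close> from
    position \<open>Suc k\<close> on. So the property must pass to subsequences, and the shift is
    undone afterwards.\<close>
  have stable: "P k (s \<circ> r)" if "strict_mono r" "P k s" for k s r
    using that eventually_subseq[OF that(1)] unfolding P_def by fastforce
  have "\<exists>c. \<forall>\<^sub>F n in sequentially. z (diagseq n) v = c" for v
  proof -
    obtain k where k: "v = e k"
      using assms by (metis UNIV_I UNIV_not_empty e_def from_nat_into_surj)
    have "P k (diagseq \<circ> (+) (Suc k))" using diagseq_holds[of k] stable by blast
    then obtain c where "\<forall>\<^sub>F n in sequentially. z (diagseq (n + Suc k)) v = c"
      by (auto simp: P_def k add.commute)
    then show ?thesis using eventually_sequentially_seg[of "\<lambda>n. z (diagseq n) v = c" "Suc k"] by blast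
  qed
  then obtain x where "\<And>v. \<forall>\<^sub>F n in sequentially. z (diagseq n) v = x v" by metis
  then show ?thesis using that subseq_diagseq by blast
qed

text \<open>Each homomorphism law mentions at most three elements, and for large \<open>n\<close>
  the map \<open>z n\<close> agrees with \<open>x\<close> at all of them; a statement free of
  \<open>n\<close> that holds eventually holds outright.\<close>

lemma bounded_lattice_hom_limit:
  fixes z :: "nat \<Rightarrow> 'a::bounded_lattice \<Rightarrow> bool"
  assumes hom: "\<And>n. bounded_lattice_hom (z n)"
    and lim: "\<And>v. \<forall>\<^sub>F n in sequentially. z n v = x v"
  shows "bounded_lattice_hom x"
proof -
  have const: "Q" if "\<forall>\<^sub>F n in sequentially. Q" for Q using that by simp
  have "x (inf u v) = (x u \<and> x v)" for u v
    by (rule const) (use lim[of u] lim[of v] lim[of "inf u v"] in eventually_elim,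
      metis bounded_lattice_homD(1)[OF hom] inf_bool_def)
  moreover have "x (sup u v) = (x u \<or> x v)" for u v
    by (rule const) (use lim[of u] lim[of v] lim[of "sup u v"] in eventually_elim,
      metis bounded_lattice_homD(2)[OF hom] sup_bool_def)
  moreover have "\<not> x bot"
    by (rule const) (use lim[of bot] in eventually_elim, simp add: bounded_lattice_homD[OF hom])
  moreover have "x top"
    by (rule const) (use lim[of top] in eventually_elim, simp add: bounded_lattice_homD[OF hom])
  ultimately show ?thesis by (simp add: bounded_lattice_hom_def)
qed

section \<open>Sequences of prime filters converging to the boundary of an ideal\<close>

text \<open>\<open>z_d\<close> makes the filters \<open>z n\<close> distinct and forbids inclusion
  of an earlier one in a later one. By \<open>x_le_y\<close>, \<open>y_a\<close> and
  \<open>y_b\<close>, neither \<open>x\<close> nor \<open>y\<close> meets the ideal.\<close>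

locale boundary_sequence =
  fixes a b :: "'a::{distrib_lattice, bounded_lattice}" and d :: "nat \<Rightarrow> 'a"
    and x y :: "'a \<Rightarrow> bool" and z :: "nat \<Rightarrow> 'a \<Rightarrow> bool"
  assumes hom_y: "bounded_lattice_hom y" and hom_z: "bounded_lattice_hom (z n)"
    and d_mem: "d n \<in> impl_ideal a b"
    and z_d: "z n (d m) \<longleftrightarrow> n < m"
    and lim: "\<forall>\<^sub>F n in sequentially. z n v = x v"
    and x_le_y: "x \<le> y" and y_a: "y a" and y_b: "\<not> y b"
    and y_nle_z: "\<not> y \<le> z n"
begin

lemma hom_x: "bounded_lattice_hom x"
  using bounded_lattice_hom_limit hom_z lim by blast

lemmas x_simps = bounded_lattice_homD[OF hom_x]
lemmas y_simps = bounded_lattice_homD[OF hom_y]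
lemmas z_simps = bounded_lattice_homD[OF hom_z]

lemma finite_differ: "finite {n. z n v \<noteq> x v}"
  using lim[of v] by (simp add: eventually_cofinite flip: cofinite_eq_sequentially)

lemma finite_z: "\<not> x v \<Longrightarrow> finite {n. z n v}"
  using finite_differ[of v] by simp

lemma finite_not_z: "x v \<Longrightarrow> finite {n. \<not> z n v}"
  using finite_differ[of v] by simp

lemma xD: "x v \<Longrightarrow> y v"
  using x_le_y by auto

lemma ideal_not_y: "v \<in> impl_ideal a b \<Longrightarrow> \<not> y v"
proof
  assume "v \<in> impl_ideal a b" "y v"
  then have "y (inf v a)" "inf v a \<le> b" using y_a by (auto simp: impl_ideal_def y_simps)
  then show False using bounded_lattice_hom_mono[OF hom_y] y_b by fastforce
qed

text \<open>If \<open>y\<close> were below \<open>x\<close>, then \<open>x\<close> would contain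
  \<open>a\<close> and omit \<open>b\<close>, hence so would \<open>z n\<close> for large
  \<open>n\<close>. But \<open>z n\<close> contains \<open>d (Suc n)\<close>, whose meet with
  \<open>a\<close> is below \<open>b\<close>.\<close>

lemma y_nle_x: "\<not> y \<le> x"
proof
  assume "y \<le> x"
  then have x: "x a" "\<not> x b" using y_a y_b xD by auto
  have "\<forall>\<^sub>F n in sequentially. z n a \<and> \<not> z n b"
    using lim[of a] lim[of b] by eventually_elim (use x in auto)
  then obtain n where n: "z n a" "\<not> z n b" by (auto simp: eventually_sequentially)
  have "z n (inf (d (Suc n)) a)" using n z_d by (simp add: z_simps)
  moreover have "inf (d (Suc n)) a \<le> b" using d_mem by (auto simp: impl_ideal_def)
  ultimately show False using n bounded_lattice_hom_mono[OF hom_z] by fastforce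
qed

text \<open>The hypothesis on \<open>N\<close> makes its filters an upset among all
  \<open>z n\<close>. Finite separation handles the indices below a bound \<open>k\<close> of
  \<open>N\<close>; the meet with \<open>d k\<close> removes all indices from \<open>k\<close> on
  and lands in the ideal.\<close>

lemma ex_ideal_element:
  assumes "finite N" and N: "\<And>n m. n \<in> N \<Longrightarrow> m \<notin> N \<Longrightarrow> \<not> z n \<le> z m"
  shows "\<exists>v\<in>impl_ideal a b. \<forall>n. z n v \<longleftrightarrow> n \<in> N"
proof -
  obtain k where k: "\<And>n. n \<in> N \<Longrightarrow> n < k"
    using assms(1) by (metis finite_nat_set_iff_bounded)
  have "\<exists>v. (\<forall>p\<in>z ` N. p v) \<and> (\<forall>q\<in>z ` ({..<k} - N). \<not> q v)"
    by (rule finite_prime_filters_separated) (use assms hom_z in auto)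
  then obtain v where v: "\<And>n. n \<in> N \<Longrightarrow> z n v" "\<And>n. n < k \<Longrightarrow> n \<notin> N \<Longrightarrow> \<not> z n v"
    by auto
  have "inf v (d k) \<in> impl_ideal a b"
    using d_mem[of k] by (auto simp: impl_ideal_def inf.assoc intro: le_infI2)
  moreover have "z n (inf v (d k)) \<longleftrightarrow> n \<in> N" for n
    using v k by (auto simp: z_simps z_d)
  ultimately show ?thesis by blast
qed

text \<open>An element of \<open>y\<close> outside \<open>x\<close> belongs to only finitely many
  \<open>z n\<close>, and \<open>y\<close> can be separated from these.\<close>

lemma ex_only_y: "\<exists>u. y u \<and> \<not> x u \<and> (\<forall>n. \<not> z n u)"
proof -
  obtain u where u: "y u" "\<not> x u" using y_nle_x by auto
  have "\<exists>v. (\<forall>p\<in>{y}. p v) \<and> (\<forall>q\<in>z ` {n. z n u}. \<not> q v)"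
    by (rule finite_prime_filters_separated) (use hom_y hom_z y_nle_z finite_z[OF u(2)] in auto)
  then obtain v where "y v" "\<And>n. z n u \<Longrightarrow> \<not> z n v" by auto
  then have "y (inf u v) \<and> \<not> x (inf u v) \<and> (\<forall>n. \<not> z n (inf u v))"
    using u by (auto simp: x_simps y_simps z_simps)
  then show ?thesis ..
qed

text \<open>Ideal elements realise \<open>N\<close> but never lie in \<open>y\<close>; a join with
  an element isolating \<open>y\<close> adds that point.\<close>

lemma ex_finite_element:
  assumes "finite N" and N: "\<And>n m. n \<in> N \<Longrightarrow> m \<notin> N \<Longrightarrow> \<not> z n \<le> z m"
  shows "\<exists>v. \<not> x v \<and> (y v \<longleftrightarrow> t) \<and> (\<forall>n. z n v \<longleftrightarrow> n \<in> N)"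
proof -
  obtain v where v: "v \<in> impl_ideal a b" "\<forall>n. z n v \<longleftrightarrow> n \<in> N"
    using ex_ideal_element[OF assms] by blast
  have nv: "\<not> y v" "\<not> x v" using ideal_not_y[OF v(1)] xD by blast+
  obtain u where "y u" "\<not> x u" "\<forall>n. \<not> z n u" using ex_only_y by blast
  then have "\<not> x (sup v u) \<and> y (sup v u) \<and> (\<forall>n. z n (sup v u) \<longleftrightarrow> n \<in> N)"
    using v(2) nv by (simp add: x_simps y_simps z_simps)
  then show ?thesis using v nv by (cases t) blast+
qed

text \<open>An element of \<open>x\<close> that avoids \<open>z n\<close> for all \<open>n\<close>
  in \<open>N\<close> misses only finitely many others. A join with an ideal element adds these,
  since in an antichain every finite index set can be realised.\<close>

lemma ex_cofinite_element:
  assumes "finite N" and anti: "\<And>m n. z m \<le> z n \<Longrightarrow> m = n" and x: "\<And>n. \<not> x \<le> z n"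
  shows "\<exists>v. x v \<and> (\<forall>n. z n v \<longleftrightarrow> n \<notin> N)"
proof -
  have "\<exists>v. (\<forall>p\<in>{x}. p v) \<and> (\<forall>q\<in>z ` N. \<not> q v)"
    by (rule finite_prime_filters_separated) (use hom_x hom_z x assms(1) in auto)
  then obtain v where v: "x v" "\<And>n. n \<in> N \<Longrightarrow> \<not> z n v" by auto
  have "finite ({n. \<not> z n v} - N)" using finite_not_z[OF v(1)] by simp
  then obtain u where "\<forall>n. z n u \<longleftrightarrow> n \<in> {n. \<not> z n v} - N"
    using ex_ideal_element[of "{n. \<not> z n v} - N"] anti by blast
  then have "x (sup v u) \<and> (\<forall>n. z n (sup v u) \<longleftrightarrow> n \<notin> N)"
    using v by (auto simp: x_simps z_simps)
  then show ?thesis ..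
qed

lemma subseq:
  assumes \<sigma>: "strict_mono \<sigma>"
  shows "boundary_sequence a b (d \<circ> \<sigma>) x y (z \<circ> \<sigma>)"
proof
  show "\<forall>\<^sub>F n in sequentially. (z \<circ> \<sigma>) n v = x v" for v
    using eventually_subseq[OF \<sigma> lim[of v]] by simp
qed (use hom_y hom_z d_mem z_d x_le_y y_a y_b y_nle_z strict_mono_less[OF \<sigma>] in auto)

end

section \<open>Existence of boundary sequences\<close>

lemma ex_boundary_sequence:
  fixes a b :: "'a::{distrib_lattice, bounded_lattice}"
  assumes cnt: "countable (UNIV :: 'a set)"
    and nomax: "\<not> (\<exists>c\<in>impl_ideal a b. \<forall>v\<in>impl_ideal a b. v \<le> c)"
  obtains d x y z where "boundary_sequence a b d x y z"
proof -
  let ?I = "impl_ideal a b"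
  have sup_I: "sup u v \<in> ?I" if "u \<in> ?I" "v \<in> ?I" for u v
    using that by (simp add: impl_ideal_def inf_sup_distrib2)
  have bot_I: "bot \<in> ?I" by (simp add: impl_ideal_def)
  have cI: "countable ?I" by (rule countable_subset[OF subset_UNIV cnt])
  define e where "e = from_nat_into ?I"
  have e_I: "e n \<in> ?I" for n using bot_I by (auto simp: e_def intro: from_nat_into)
  have e_surj: "\<exists>n. v = e n" if "v \<in> ?I" for v
    using from_nat_into_surj[OF cI that] by (auto simp: e_def)
  \<comment> \<open>Each step joins an ideal element not below the current one, for strictness, and
    the next enumerated one, for cofinality.\<close>
  have "\<exists>d. \<forall>n. d n \<in> ?I \<and> (d n \<le> d (Suc n) \<and> \<not> d (Suc n) \<le> d n \<and> e n \<le> d (Suc n))"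
  proof (rule dependent_nat_choice)
    show "\<exists>u. u \<in> ?I" using bot_I by blast
  next
    fix u n assume u: "u \<in> ?I"
    obtain v where v: "v \<in> ?I" "\<not> v \<le> u" using nomax u by blast
    have "sup (sup u v) (e n) \<in> ?I" using u v e_I sup_I by blast
    moreover have "\<not> sup (sup u v) (e n) \<le> u" using v by simp
    ultimately show "\<exists>w. w \<in> ?I \<and> (u \<le> w \<and> \<not> w \<le> u \<and> e n \<le> w)"
      by (meson sup.cobounded2 sup.cobounded1 order_trans)
  qed
  then obtain d where d_I: "\<And>n. d n \<in> ?I" and d_Suc: "\<And>n. d n \<le> d (Suc n)"
    and d_strict: "\<And>n. \<not> d (Suc n) \<le> d n" and d_e: "\<And>n. e n \<le> d (Suc n)" by blast
  have d_mono: "d m \<le> d n" if "m \<le> n" for m n by (rule lift_Suc_mono_le[of d, OF d_Suc that])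
  have "\<exists>p. bounded_lattice_hom p \<and> p (d (Suc n)) \<and> \<not> p (d n)" for n
    using prime_filter_separates[OF d_strict] by metis
  then obtain z0 where z0: "\<And>n. bounded_lattice_hom (z0 n)" "\<And>n. z0 n (d (Suc n))"
    "\<And>n. \<not> z0 n (d n)" by metis
  have z0_d: "z0 n (d m) \<longleftrightarrow> n < m" for n m
    using z0(2,3) bounded_lattice_hom_mono[OF z0(1) d_mono]
    by (metis Suc_leI le_boolD linorder_not_less)
  obtain \<sigma> x where \<sigma>: "strict_mono \<sigma>" and x0: "\<And>v. \<forall>\<^sub>F n in sequentially. z0 (\<sigma> n) v = x v"
    using pointwise_convergent_subseq[OF cnt] by blast
  have hom_x: "bounded_lattice_hom x"
    by (rule bounded_lattice_hom_limit[where z = "z0 \<circ> \<sigma>"]) (use z0(1) x0 in auto)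
  note xs = bounded_lattice_homD[OF hom_x]
  \<comment> \<open>Since \<open>\<sigma> n\<close> is at least \<open>n\<close>, the filters of the
    subsequence with index at least \<open>m\<close> omit \<open>d m\<close>. Cofinality of
    \<open>d\<close> then extends this to the whole ideal.\<close>
  have x_d: "\<not> x (d m)" for m
  proof -
    have "\<forall>\<^sub>F n in sequentially. \<not> x (d m)"
      using x0[of "d m"] eventually_ge_at_top[of m]
    proof eventually_elim
      case (elim n)
      then show ?case using z0_d[of "\<sigma> n" m] strict_mono_imp_increasing[OF \<sigma>, of n] by auto
    qed
    then show ?thesis by simp
  qed
  have x_I: "\<not> x v" if "v \<in> ?I" for v
    using e_surj[OF that] d_e x_d bounded_lattice_hom_mono[OF hom_x] by (metis le_boolD)
  \<comment> \<open>The filter generated by \<open>x\<close> and \<open>a\<close> omits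
    \<open>b\<close>: an \<open>f\<close> in \<open>x\<close> with \<open>inf f a\<close> below
    \<open>b\<close> would lie in the ideal, which \<open>x\<close> misses.\<close>
  have "lattice_filter {v. x v}"
    unfolding lattice_filter_def using bounded_lattice_hom_mono[OF hom_x] by (auto simp: xs)
  then have "lattice_filter {w. \<exists>f\<in>{v. x v}. inf f a \<le> w}" by (rule lattice_filter_adjoin)
  moreover have "b \<notin> {w. \<exists>f\<in>{v. x v}. inf f a \<le> w}"
    using x_I by (auto simp: impl_ideal_def)
  ultimately obtain y where y: "bounded_lattice_hom y" "\<not> y b"
    "\<And>u. u \<in> {w. \<exists>f\<in>{v. x v}. inf f a \<le> w} \<Longrightarrow> y u"
    by (rule prime_filter_extension) blast
  have y_a: "y a" using y(3)[of a] xs(4) by auto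
  have xy: "x \<le> y" using y(3) by (auto intro!: le_infI1)
  \<comment> \<open>As \<open>d (Suc n)\<close> lies in \<open>z0 n\<close>, no \<open>z0 n\<close>
    contains \<open>a\<close> without \<open>b\<close>; in the limit neither does \<open>x\<close>,
    whereas \<open>y\<close> does.\<close>
  have zb: "z0 n b" if "z0 n a" for n
  proof -
    have "z0 n (inf (d (Suc n)) a)"
      using that z0(2) by (simp add: bounded_lattice_homD[OF z0(1)])
    moreover have "inf (d (Suc n)) a \<le> b" using d_I by (auto simp: impl_ideal_def)
    ultimately show ?thesis using bounded_lattice_hom_mono[OF z0(1)] by fastforce
  qed
  have "\<not> y \<le> x"
  proof
    assume "y \<le> x"
    then have "x a" "\<not> x b" using y_a xy y(2) by auto
    have "\<forall>\<^sub>F n in sequentially. False"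
      using x0[of a] x0[of b] by eventually_elim (use \<open>x a\<close> \<open>\<not> x b\<close> zb in auto)
    then show False by simp
  qed
  \<comment> \<open>This \<open>u\<close> lies in only finitely many filters of the sequence;
    dropping the first \<open>k\<close> leaves none that contains \<open>y\<close>.\<close>
  then obtain u where u: "y u" "\<not> x u" by auto
  then obtain k where k: "\<And>n. n \<ge> k \<Longrightarrow> \<not> z0 (\<sigma> n) u"
    using x0[of u] by (auto simp: eventually_sequentially)
  define \<tau> where "\<tau> n = \<sigma> (n + k)" for n
  have \<tau>: "strict_mono \<tau>" using \<sigma> by (simp add: \<tau>_def strict_mono_def)
  have "boundary_sequence a b (d \<circ> \<tau>) x y (z0 \<circ> \<tau>)"
  proof
    show "\<forall>\<^sub>F n in sequentially. (z0 \<circ> \<tau>) n v = x v" for v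
      using x0[of v] unfolding \<tau>_def comp_def
      by (subst eventually_sequentially_seg)
    show "\<not> y \<le> (z0 \<circ> \<tau>) n" for n
      using k[of "n + k"] u by (auto simp: \<tau>_def)
  qed (use y y_a xy z0 d_I z0_d strict_mono_less[OF \<tau>] in auto)
  then show ?thesis using that by blast
qed

lemma ex_homogeneous_boundary_sequence:
  fixes a b :: "'a::{distrib_lattice, bounded_lattice}"
  assumes "countable (UNIV :: 'a set)"
    and "\<not> (\<exists>c\<in>impl_ideal a b. \<forall>v\<in>impl_ideal a b. v \<le> c)"
  obtains d x y z where "boundary_sequence a b d x y z"
    "(\<forall>m n. m \<le> n \<longrightarrow> z n \<le> z m) \<or>
     (\<forall>m n. z m \<le> z n \<longrightarrow> m = n) \<and> ((\<forall>n. x \<le> z n) \<or> (\<forall>n. \<not> x \<le> z n))"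
proof -
  obtain d x y z where b0: "boundary_sequence a b d x y z" using ex_boundary_sequence[OF assms] .
  \<comment> \<open>Comparability with \<open>x\<close> is made uniform first; the Ramsey
    subsequence inherits it.\<close>
  obtain \<sigma> :: "nat \<Rightarrow> nat" and c where \<sigma>: "strict_mono \<sigma>" "\<And>n. x \<le> z (\<sigma> n) \<longleftrightarrow> c"
    by (rule constant_subseq[of "\<lambda>n. x \<le> z n"]) blast
  define w where "w = z \<circ> \<sigma>"
  \<comment> \<open>Colour 0 means that the later filter of the pair is contained in the earlier
    one. The opposite inclusion contradicts \<open>z_d\<close>, so colour 1 means
    incomparable.\<close>
  define f where "f S = (if w (Max S) \<le> w (Min S) then 0 else 1::nat)" for S
  have "\<forall>m\<in>UNIV. \<forall>n\<in>UNIV. m \<noteq> n \<longrightarrow> f {m, n} < 2" by (simp add: f_def)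
  from Ramsey2[OF infinite_UNIV_nat this] obtain N t where N: "infinite N"
    and t: "\<forall>m\<in>N. \<forall>n\<in>N. m \<noteq> n \<longrightarrow> f {m, n} = t"
    by blast
  obtain \<tau> :: "nat \<Rightarrow> nat" where \<tau>: "strict_mono \<tau>" "\<And>n. \<tau> n \<in> N" using infinite_set_subseq[OF N] by blast
  have b1: "boundary_sequence a b (d \<circ> \<sigma>) x y w"
    unfolding w_def using boundary_sequence.subseq[OF b0 \<sigma>(1)] .
  then have b2: "boundary_sequence a b (d \<circ> \<sigma> \<circ> \<tau>) x y (w \<circ> \<tau>)"
    by (rule boundary_sequence.subseq[OF _ \<tau>(1)])
  interpret boundary_sequence a b "d \<circ> \<sigma> \<circ> \<tau>" x y "w \<circ> \<tau>" by (rule b2)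
  have f: "w (\<tau> n) \<le> w (\<tau> m) \<longleftrightarrow> t = 0" if "m < n" for m n
  proof -
    have "\<tau> m < \<tau> n" using that \<tau>(1) by (simp add: strict_mono_less)
    moreover have "f {\<tau> m, \<tau> n} = t" using t \<tau>(2) calculation by simp
    ultimately show ?thesis by (simp add: f_def split: if_splits)
  qed
  have up: "\<not> w (\<tau> m) \<le> w (\<tau> n)" if "m < n" for m n
    using z_d[of m n] z_d[of n n] that by auto
  have x: "(\<forall>n. x \<le> w (\<tau> n)) \<or> (\<forall>n. \<not> x \<le> w (\<tau> n))"
    using \<sigma>(2) by (auto simp: w_def)
  show ?thesis
  proof (rule that[OF b2], cases "t = 0")
    case True
    then have "\<forall>m n. m \<le> n \<longrightarrow> w (\<tau> n) \<le> w (\<tau> m)"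
      using f by (metis le_less order_refl)
    then show "(\<forall>m n. m \<le> n \<longrightarrow> (w \<circ> \<tau>) n \<le> (w \<circ> \<tau>) m) \<or>
      (\<forall>m n. (w \<circ> \<tau>) m \<le> (w \<circ> \<tau>) n \<longrightarrow> m = n) \<and> ((\<forall>n. x \<le> (w \<circ> \<tau>) n) \<or> (\<forall>n. \<not> x \<le> (w \<circ> \<tau>) n))"
      by simp
  next
    case False
    then have "\<forall>m n. w (\<tau> m) \<le> w (\<tau> n) \<longrightarrow> m = n"
      using f up by (metis linorder_neqE_nat)
    then show "(\<forall>m n. m \<le> n \<longrightarrow> (w \<circ> \<tau>) n \<le> (w \<circ> \<tau>) m) \<or>
      (\<forall>m n. (w \<circ> \<tau>) m \<le> (w \<circ> \<tau>) n \<longrightarrow> m = n) \<and> ((\<forall>n. x \<le> (w \<circ> \<tau>) n) \<or> (\<forall>n. \<not> x \<le> (w \<circ> \<tau>) n))"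
      using x by simp
  qed
qed

section \<open>The homomorphisms onto \<open>L\<^sub>1\<close>, \<open>L\<^sub>2\<close> and \<open>L\<^sub>3\<close>\<close>

lemma Z1_all:
  fixes P :: "Z1 \<Rightarrow> bool"
  shows "(\<forall>p. P p) \<longleftrightarrow> P None \<and> P (Some y_pt) \<and> (\<forall>n. P (Some (z_pt n)))"
  by (metis Z1_discrete.exhaust option.exhaust)

text \<open>\<open>n\<close> counts the points \<open>z_pt i\<close> in the set:
  \<open>n = 0\<close> covers the empty set and the singleton of \<open>y_pt\<close>, and the upset
  of \<open>z_pt n\<close> has count \<open>Suc n\<close>.\<close>

lemma L1_cases:
  obtains "Rep_L1 l = UNIV"
  | n t where "Rep_L1 l = {p. (p = Some y_pt \<and> t) \<or> (\<exists>i<n. p = Some (z_pt i))}"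
proof -
  have "Rep_L1 l \<in> {{}, {Some y_pt}, UNIV} \<union>
     range (\<lambda>n. (Some \<circ> z_pt) ` {..n}) \<union>
     range (\<lambda>n. insert (Some y_pt) ((Some \<circ> z_pt) ` {..n}))"
    using Rep_L1[of l] unfolding Z1_clopen_upsets .
  then consider "Rep_L1 l = UNIV" | "Rep_L1 l = {}" | "Rep_L1 l = {Some y_pt}"
    | n where "Rep_L1 l = (Some \<circ> z_pt) ` {..n}"
    | n where "Rep_L1 l = insert (Some y_pt) ((Some \<circ> z_pt) ` {..n})" by blast
  then show ?thesis
  proof cases
    case 1 then show ?thesis using that(1) by blast
  next
    case 2 then show ?thesis using that(2)[of False 0] by simp
  next
    case 3 then show ?thesis using that(2)[of True 0] by simp
  next
    case (4 n) then show ?thesis using that(2)[of False "Suc n"] by (auto simp: less_Suc_eq_le)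
  next
    case (5 n) then show ?thesis using that(2)[of True "Suc n"] by (auto simp: less_Suc_eq_le)
  qed
qed

lemma impl_ideal_c1: "l \<in> impl_ideal c1 bot \<longleftrightarrow> Some y_pt \<notin> Rep_L1 l"
  unfolding impl_ideal_def mem_Collect_eq less_eq_L1.rep_eq inf_L1.rep_eq bot_L1.rep_eq c1.rep_eq
  by auto

lemma impl_ideal_c2:
  "l \<in> impl_ideal c2 bot \<longleftrightarrow> (\<exists>S. l = top.Value S \<and> 0 |\<notin>| S)"
  by (cases l) (auto simp: impl_ideal_def c2_def inf_top_def bot_top_def less_eq_top_def)

lemma impl_ideal_c3: "l \<in> impl_ideal c3 bot \<longleftrightarrow> \<not> snd (Rep_L3 l)"
  unfolding impl_ideal_def mem_Collect_eq less_eq_L3.rep_eq inf_L3.rep_eq bot_L3.rep_eq c3.rep_eq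
  by (cases "Rep_L3 l") (auto simp: bot_prod_def inf_prod_def)

context boundary_sequence
begin

text \<open>Dual to the map \<open>pt\<close> from \<open>Z1\<close> to prime filters:
  \<open>h v\<close> is the set of points whose filter contains \<open>v\<close>, an upset since
  \<open>pt\<close> is monotone and clopen since the \<open>z n\<close> converge to
  \<open>x\<close>.\<close>

lemma hom_onto_L1:
  assumes chain: "\<And>m n. m \<le> n \<Longrightarrow> z n \<le> z m"
  shows "\<exists>h :: 'a \<Rightarrow> L1. bounded_lattice_hom h \<and> surj h \<and> h ` impl_ideal a b = impl_ideal c1 bot"
proof -
  define pt where "pt p = (case p of None \<Rightarrow> x | Some y_pt \<Rightarrow> y | Some (z_pt n) \<Rightarrow> z n)" for p
  have pt_simps [simp]: "pt None = x" "pt (Some y_pt) = y" "pt (Some (z_pt n)) = z n" for n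
    by (auto simp: pt_def)
  have hom_pt: "bounded_lattice_hom (pt p)" for p
    using hom_x hom_y hom_z by (auto simp: pt_def split: option.split Z1_discrete.split)
  note ps = bounded_lattice_homD[OF hom_pt]
  \<comment> \<open>An element of \<open>x\<close> lies in some later \<open>z m\<close>, which is
    contained in \<open>z n\<close>.\<close>
  have x_z: "z n v" if "x v" for n v
  proof -
    have "\<forall>\<^sub>F m in sequentially. z n v"
      using lim[of v] eventually_ge_at_top[of n] by eventually_elim (use that chain in auto)
    then show ?thesis by simp
  qed
  \<comment> \<open>If \<open>x\<close> contains \<open>v\<close>, the set is the whole space;
    otherwise it is finite and avoids \<open>None\<close>.\<close>
  have mem: "{p. pt p v} \<in> {U. openin Z1_topology U \<and> closedin Z1_topology U \<and> Z1_upset U}" for v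
  proof -
    have pt_x: "pt p v" if "x v" for p
      using Z1_all[of "\<lambda>p. pt p v"] that xD x_z by simp
    have pt_mono: "pt q v" if le: "Z1_le p q" "pt p v" for p q
    proof (cases "(p, q)" rule: Z1_le.cases)
      case (1 q')
      then show ?thesis using le pt_x by simp
    next
      case (2 q')
      then show ?thesis using le by simp
    next
      case (3 n q')
      then obtain m where "m \<le> n" "q = Some (z_pt m)" using le by auto
      then show ?thesis using 3 le predicate1D[OF chain] by auto
    qed
    have fin: "finite {p. pt p v}" if "\<not> x v"
    proof (rule finite_subset)
      show "{p. pt p v} \<subseteq> insert (Some y_pt) ((Some \<circ> z_pt) ` {n. z n v})"
        using that by (simp add: subset_iff Z1_all image_iff)
    qed (use finite_z[OF that] in simp)
    have "openin Z1_topology {p. pt p v}"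
      unfolding openin_Z1 using pt_x by (cases "x v") simp_all
    moreover have "closedin Z1_topology {p. pt p v}"
      unfolding closedin_def topspace_Z1 openin_Z1 using pt_x fin
      by (cases "x v") (simp_all flip: Compl_eq_Diff_UNIV)
    ultimately show ?thesis using pt_mono unfolding Z1_upset_def by blast
  qed
  define h where "h v = Abs_L1 {p. pt p v}" for v
  have Rep_h: "Rep_L1 (h v) = {p. pt p v}" for v
    unfolding h_def by (rule Abs_L1_inverse[OF mem])
  have h_eq: "h v = l" if "Rep_L1 l = {p. pt p v}" for v l
    using that Rep_h Rep_L1_inject by metis
  have "bounded_lattice_hom h"
    unfolding bounded_lattice_hom_def
    by (auto intro!: h_eq simp: inf_L1.rep_eq sup_L1.rep_eq bot_L1.rep_eq top_L1.rep_eq Rep_h ps)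
  moreover have down: "\<not> z n \<le> z m" if "n \<in> {..<k}" "m \<notin> {..<k}" for n m k
    using that z_d[of n m] z_d[of m m] by auto
  have "\<exists>v. h v = l" for l
  proof (cases l rule: L1_cases)
    case 1
    then have "h top = l" by (intro h_eq) (simp add: ps)
    then show ?thesis ..
  next
    case (2 n t)
    obtain v where v: "\<not> x v" "y v \<longleftrightarrow> t" "\<forall>m. z m v \<longleftrightarrow> m \<in> {..<n}"
      using ex_finite_element[of "{..<n}"] down by blast
    have "h v = l"
      using 2 v by (intro h_eq) (simp add: set_eq_iff Z1_all)
    then show ?thesis ..
  qed
  then have "surj h" by (metis surjI)
  moreover have "h ` impl_ideal a b = impl_ideal c1 bot"
  proof
    show "h ` impl_ideal a b \<subseteq> impl_ideal c1 bot"
      by (auto simp: impl_ideal_c1 Rep_h dest: ideal_not_y)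
    show "impl_ideal c1 bot \<subseteq> h ` impl_ideal a b"
    proof
      fix l assume l: "l \<in> impl_ideal c1 bot"
      then show "l \<in> h ` impl_ideal a b"
      proof (cases l rule: L1_cases)
        case 1
        then show ?thesis using l by (simp add: impl_ideal_c1)
      next
        case (2 n t)
        then have t: "\<not> t" using l by (simp add: impl_ideal_c1)
        obtain v where v: "v \<in> impl_ideal a b" "\<forall>m. z m v \<longleftrightarrow> m \<in> {..<n}"
          using ex_ideal_element[of "{..<n}"] down by blast
        have "\<not> y v" "\<not> x v" using ideal_not_y[OF v(1)] xD by blast+
        then have "h v = l"
          using 2 t v(2)
          by (intro h_eq) (simp add: set_eq_iff Z1_all)
        then show ?thesis using v(1) by blast
      qed
    qed
  qed
  ultimately show ?thesis by blast
qed

text \<open>Here \<open>x\<close> lies below all other points, so if it contains \<open>v\<close>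
  they all do, and \<open>v\<close> goes to the added top. Otherwise only finitely many points
  contain \<open>v\<close>.\<close>

lemma hom_onto_L2:
  assumes anti: "\<And>m n. z m \<le> z n \<Longrightarrow> m = n" and x_le_z: "\<And>n. x \<le> z n"
  shows "\<exists>h :: 'a \<Rightarrow> L2. bounded_lattice_hom h \<and> surj h \<and> h ` impl_ideal a b = impl_ideal c2 bot"
proof -
  \<comment> \<open>\<open>y\<close> receives the number 0 to match \<open>c2\<close>, and
    \<open>z n\<close> the number \<open>Suc n\<close>.\<close>
  define pt where "pt = case_nat y z"
  have pt_simps [simp]: "pt 0 = y" "pt (Suc n) = z n" for n by (auto simp: pt_def)
  have hom_pt: "bounded_lattice_hom (pt n)" for n
    using hom_y hom_z by (cases n) auto
  note ps = bounded_lattice_homD[OF hom_pt]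
  have x_pt: "pt n v" if "x v" for n v
    using that x_le_y x_le_z by (cases n) auto
  have fin: "finite {n. pt n v}" if "\<not> x v" for v
  proof (rule finite_subset)
    show "{n. pt n v} \<subseteq> insert 0 (Suc ` {n. z n v})"
    proof
      fix n assume "n \<in> {n. pt n v}"
      then show "n \<in> insert 0 (Suc ` {n. z n v})" by (cases n) auto
    qed
  qed (use finite_z[OF that] in simp)
  \<comment> \<open>The value of \<open>Abs_fset\<close> is meaningful only for finite sets, so
    \<open>F v\<close> is used only when \<open>x\<close> omits \<open>v\<close>.\<close>
  define F where "F v = Abs_fset {n. pt n v}" for v
  have mem_F: "n |\<in>| F v \<longleftrightarrow> pt n v" if "\<not> x v" for n v
    using fin[OF that] by (simp add: F_def Abs_fset_inverse)
  define h where "h v = (if x v then top.Top else top.Value (F v))" for v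
  have h_Top: "h v = top.Top" if "x v" for v using that by (simp add: h_def)
  have h_Value: "h v = top.Value S" if "\<not> x v" "\<And>n. n |\<in>| S \<longleftrightarrow> pt n v" for v S
    using that mem_F[of v] by (simp add: h_def fset_eq_iff)
  have h_F: "h v = top.Value (F v)" if "\<not> x v" for v using that by (simp add: h_def)
  have inf_h: "h (inf u v) = inf (h u) (h v)" for u v
  proof (cases "x u \<and> x v")
    case True
    then show ?thesis by (simp add: h_Top x_simps inf_top_def)
  next
    case False
    then consider "x u" "\<not> x v" | "\<not> x u" "x v" | "\<not> x u" "\<not> x v" by blast
    then show ?thesis
      by cases (simp_all add: h_Top h_F inf_top_def fset_eq_iff x_simps ps mem_F x_pt)
  qed
  have sup_h: "h (sup u v) = sup (h u) (h v)" for u v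
  proof (cases "x u \<or> x v")
    case True
    then show ?thesis by (auto simp: h_Top x_simps sup_top_def split: top.split)
  next
    case False
    then show ?thesis by (simp add: h_F sup_top_def fset_eq_iff x_simps ps mem_F)
  qed
  have "h bot = bot" unfolding bot_top_def by (rule h_Value) (simp_all add: x_simps ps)
  moreover have "h top = top" by (simp add: h_Top x_simps top_top_def)
  ultimately have "bounded_lattice_hom h"
    using inf_h sup_h by (simp add: bounded_lattice_hom_def)
  moreover have fin_N: "finite {n. Suc n |\<in>| S}" for S
    using finite_vimageI[of "fset S" Suc] by (simp add: vimage_def)
  have ex: "\<exists>v. \<not> x v \<and> (y v \<longleftrightarrow> t) \<and> (\<forall>n. z n v \<longleftrightarrow> n \<in> {n. Suc n |\<in>| S})" for S t
    by (rule ex_finite_element[OF fin_N]) (use anti in blast)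
  have ex_I: "\<exists>v\<in>impl_ideal a b. \<forall>n. z n v \<longleftrightarrow> n \<in> {n. Suc n |\<in>| S}" for S
    by (rule ex_ideal_element[OF fin_N]) (use anti in blast)
  have "\<exists>v. h v = l" for l
  proof (cases l)
    case (Value S)
    obtain v where "\<not> x v" "y v \<longleftrightarrow> 0 |\<in>| S" "\<forall>n. z n v \<longleftrightarrow> n \<in> {n. Suc n |\<in>| S}"
      using ex by blast
    then have "h v = top.Value S"
      by (intro h_Value) (auto simp: pt_def split: nat.splits)
    then show ?thesis using Value by blast
  next
    case Top
    then have "h top = l" by (simp add: h_def x_simps)
    then show ?thesis ..
  qed
  then have "surj h" by (metis surjI)
  moreover have "h ` impl_ideal a b = impl_ideal c2 bot"
  proof
    show "h ` impl_ideal a b \<subseteq> impl_ideal c2 bot"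
    proof (rule image_subsetI)
      fix v assume "v \<in> impl_ideal a b"
      then have "\<not> y v" "\<not> x v" using ideal_not_y xD by blast+
      then show "h v \<in> impl_ideal c2 bot" by (simp add: impl_ideal_c2 h_F mem_F)
    qed
    show "impl_ideal c2 bot \<subseteq> h ` impl_ideal a b"
    proof
      fix l assume "l \<in> impl_ideal c2 bot"
      then obtain S where S0: "l = top.Value S" "0 |\<notin>| S" by (auto simp: impl_ideal_c2)
      obtain v where v: "v \<in> impl_ideal a b" "\<forall>n. z n v \<longleftrightarrow> n \<in> {n. Suc n |\<in>| S}"
        using ex_I by blast
      have "h v = l"
        using S0 v(2) ideal_not_y[OF v(1)] xD unfolding S0(1)
        by (intro h_Value) (auto simp: pt_def split: nat.splits)
      then show "l \<in> h ` impl_ideal a b" using v(1) by blast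
    qed
  qed
  ultimately show ?thesis by blast
qed

text \<open>The point \<open>x\<close> gets no coordinate: it contains \<open>v\<close> exactly when
  cofinitely many \<open>z n\<close> do, and then \<open>y\<close> contains \<open>v\<close> too. As
  \<open>x\<close> is below no \<open>z n\<close>, every cofinite set occurs.\<close>

lemma hom_onto_L3:
  assumes anti: "\<And>m n. z m \<le> z n \<Longrightarrow> m = n" and x_nle_z: "\<And>n. \<not> x \<le> z n"
  shows "\<exists>h :: 'a \<Rightarrow> L3. bounded_lattice_hom h \<and> surj h \<and> h ` impl_ideal a b = impl_ideal c3 bot"
proof -
  define h where "h v = Abs_L3 ({n. z n v}, y v)" for v
  have mem: "({n. z n v}, y v) \<in> {(A, n) \<in> CF \<times> (UNIV :: bool set). finite A \<or> n = True}" for v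
    using finite_z[of v] finite_not_z[of v] xD[of v]
    by (cases "x v") (auto simp: CF_def Collect_neg_eq)
  have Rep_h: "Rep_L3 (h v) = ({n. z n v}, y v)" for v
    unfolding h_def by (rule Abs_L3_inverse[OF mem])
  have h_eq: "h v = l" if "Rep_L3 l = ({n. z n v}, y v)" for v l
    using that Rep_h Rep_L3_inject by metis
  have "bounded_lattice_hom h"
    unfolding bounded_lattice_hom_def
    by (auto intro!: h_eq simp: inf_L3.rep_eq sup_L3.rep_eq bot_L3.rep_eq top_L3.rep_eq Rep_h
        y_simps z_simps bot_prod_def top_prod_def)
  moreover have "\<exists>v. h v = l" for l
  proof -
    obtain A t where At: "Rep_L3 l = (A, t)" by fastforce
    then have A: "finite A \<or> finite (- A) \<and> t"
      using Rep_L3[of l] by (auto simp: CF_def)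
    show ?thesis
    proof (cases "finite A")
      case True
      then obtain v where "y v \<longleftrightarrow> t" "\<forall>n. z n v \<longleftrightarrow> n \<in> A"
        using ex_finite_element[of A] anti by blast
      then have "h v = l" by (intro h_eq) (auto simp: At)
      then show ?thesis ..
    next
      case False
      \<comment> \<open>As \<open>A\<close> is infinite, its complement is finite and
        \<open>t\<close> holds; \<open>y\<close> contains the witness because \<open>x\<close>
        does.\<close>
      then obtain v where "x v" "\<forall>n. z n v \<longleftrightarrow> n \<notin> - A"
        using A ex_cofinite_element[OF _ anti x_nle_z] by blast
      then have "h v = l" using A False xD by (intro h_eq) (auto simp: At)
      then show ?thesis ..
    qed
  qed
  then have "surj h" by (metis surjI)
  moreover have "h ` impl_ideal a b = impl_ideal c3 bot"
  proof
    show "h ` impl_ideal a b \<subseteq> impl_ideal c3 bot"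
      by (auto simp: impl_ideal_c3 Rep_h dest: ideal_not_y)
    show "impl_ideal c3 bot \<subseteq> h ` impl_ideal a b"
    proof
      fix l assume "l \<in> impl_ideal c3 bot"
      then obtain A where A: "Rep_L3 l = (A, False)"
        unfolding impl_ideal_c3 by (metis (full_types) prod.collapse)
      then have "finite A" using Rep_L3[of l] by auto
      then obtain v where v: "v \<in> impl_ideal a b" "\<forall>n. z n v \<longleftrightarrow> n \<in> A"
        using ex_ideal_element[of A] anti by blast
      then have "h v = l" using A ideal_not_y by (intro h_eq) auto
      then show "l \<in> h ` impl_ideal a b" using v(1) by blast
    qed
  qed
  ultimately show ?thesis by blast
qed

end

section \<open>The ideals \<open>I\<^bsub>c\<^sub>i\<rightarrow>0\<^esub>\<close> are not principal\<close>

text \<open>The upset of each \<open>z_pt n\<close> is in the ideal, so a bound contains all these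
  points; the only clopen upset that does is the whole space, which contains
  \<open>y_pt\<close>.\<close>

lemma impl_ideal_c1_no_max: "\<not> (\<exists>m\<in>impl_ideal c1 bot. \<forall>l\<in>impl_ideal c1 bot. l \<le> m)"
proof
  assume "\<exists>m\<in>impl_ideal c1 bot. \<forall>l\<in>impl_ideal c1 bot. l \<le> m"
  then obtain m where m: "Some y_pt \<notin> Rep_L1 m"
    and ub: "\<And>l. Some y_pt \<notin> Rep_L1 l \<Longrightarrow> Rep_L1 l \<subseteq> Rep_L1 m"
    by (auto simp: impl_ideal_c1 less_eq_L1.rep_eq)
  have z: "Some (z_pt n) \<in> Rep_L1 m" for n
  proof -
    have "(Some \<circ> z_pt) ` {..n} \<in>
        {U. openin Z1_topology U \<and> closedin Z1_topology U \<and> Z1_upset U}"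
      unfolding Z1_clopen_upsets by blast
    then have "Rep_L1 (Abs_L1 ((Some \<circ> z_pt) ` {..n})) = (Some \<circ> z_pt) ` {..n}"
      by (rule Abs_L1_inverse)
    then show ?thesis using ub[of "Abs_L1 ((Some \<circ> z_pt) ` {..n})"] by auto
  qed
  show False
  proof (cases m rule: L1_cases)
    case 1
    then show ?thesis using m by simp
  next
    case (2 n t)
    then show ?thesis using z[of n] by simp
  qed
qed

text \<open>A greatest element would be a finite set containing every \<open>Suc n\<close>.\<close>

lemma impl_ideal_c2_no_max: "\<not> (\<exists>m\<in>impl_ideal c2 bot. \<forall>l\<in>impl_ideal c2 bot. l \<le> m)"
proof
  assume "\<exists>m\<in>impl_ideal c2 bot. \<forall>l\<in>impl_ideal c2 bot. l \<le> m"
  then obtain m where m: "m \<in> impl_ideal c2 bot" "\<And>l. l \<in> impl_ideal c2 bot \<Longrightarrow> l \<le> m"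
    by blast
  then obtain S where S: "m = top.Value S" unfolding impl_ideal_c2 by blast
  have "T |\<subseteq>| S" if "0 |\<notin>| T" for T
    using m(2)[of "top.Value T"] that by (simp add: impl_ideal_c2 S less_eq_top_def)
  then have "Suc n |\<in>| S" for n
    by (metis finsert_fsubset finsert_iff fempty_iff nat.distinct(1))
  then have "range Suc \<subseteq> fset S" by auto
  then have "finite (range Suc)" using finite_fset by (rule finite_subset)
  then show False using range_inj_infinite[OF inj_Suc] by blast
qed

text \<open>The pairs \<open>({n}, False)\<close> force the first component of a bound to be
  everything; an infinite first component forces the second to be \<open>True\<close>, outside the
  ideal.\<close>

lemma impl_ideal_c3_no_max: "\<not> (\<exists>m\<in>impl_ideal c3 bot. \<forall>l\<in>impl_ideal c3 bot. l \<le> m)"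
proof
  assume "\<exists>m\<in>impl_ideal c3 bot. \<forall>l\<in>impl_ideal c3 bot. l \<le> m"
  then obtain m where m: "\<not> snd (Rep_L3 m)"
    and ub: "\<And>l. \<not> snd (Rep_L3 l) \<Longrightarrow> Rep_L3 l \<le> Rep_L3 m"
    by (auto simp: impl_ideal_c3 less_eq_L3.rep_eq)
  have "n \<in> fst (Rep_L3 m)" for n
  proof -
    have "Rep_L3 (Abs_L3 ({n}, False)) = ({n}, False)"
      by (rule Abs_L3_inverse) (simp add: CF_def)
    then show ?thesis using ub[of "Abs_L3 ({n}, False)"] by (auto simp: less_eq_prod_def)
  qed
  then have "fst (Rep_L3 m) = UNIV" by auto
  then show False using Rep_L3[of m] m by (cases "Rep_L3 m") auto
qed

section \<open>Heyting implications as greatest elements, and the equivalence\<close>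

lemma heyting_algebra_iff:
  "heyting_algebra TYPE('a::{distrib_lattice, bounded_lattice}) \<longleftrightarrow>
    (\<forall>a b :: 'a. \<exists>c\<in>impl_ideal a b. \<forall>v\<in>impl_ideal a b. v \<le> c)"
proof -
  have "(\<forall>x. inf a x \<le> b \<longleftrightarrow> x \<le> c) \<longleftrightarrow> c \<in> impl_ideal a b \<and> (\<forall>v\<in>impl_ideal a b. v \<le> c)"
    for a b c :: 'a
  proof
    assume "\<forall>x. inf a x \<le> b \<longleftrightarrow> x \<le> c"
    then show "c \<in> impl_ideal a b \<and> (\<forall>v\<in>impl_ideal a b. v \<le> c)"
      by (simp add: impl_ideal_def inf.commute[of _ a])
  next
    assume c: "c \<in> impl_ideal a b \<and> (\<forall>v\<in>impl_ideal a b. v \<le> c)"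
    show "\<forall>x. inf a x \<le> b \<longleftrightarrow> x \<le> c"
    proof (intro allI iffI)
      fix x assume "inf a x \<le> b"
      then show "x \<le> c" using c by (simp add: impl_ideal_def inf.commute[of _ a])
    next
      fix x assume "x \<le> c"
      then have "inf a x \<le> inf a c" by (rule inf_mono[OF order_refl])
      also have "\<dots> \<le> b" using c by (simp add: impl_ideal_def inf.commute[of _ a])
      finally show "inf a x \<le> b" .
    qed
  qed
  then show ?thesis by (simp add: heyting_algebra_def Bex_def)
qed

lemma not_heyting_algebra_if_image_no_max:
  fixes h :: "'a::{distrib_lattice, bounded_lattice} \<Rightarrow> 'b::bounded_lattice"
  assumes h: "bounded_lattice_hom h" "h ` impl_ideal a b = J"
    and J: "\<not> (\<exists>m\<in>J. \<forall>l\<in>J. l \<le> m)"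
  shows "\<not> heyting_algebra TYPE('a)"
proof
  assume "heyting_algebra TYPE('a)"
  then obtain c where "c \<in> impl_ideal a b" "\<forall>v\<in>impl_ideal a b. v \<le> c"
    unfolding heyting_algebra_iff by blast
  then have "h c \<in> J" "\<forall>l\<in>J. l \<le> h c"
    using h(2) bounded_lattice_hom_mono[OF h(1)] by auto
  then show False using J by blast
qed

theorem theorem3p3:
  assumes "countable (UNIV :: 'a::{distrib_lattice, bounded_lattice} set)"
  shows "\<not> heyting_algebra TYPE('a) \<longleftrightarrow>
    (\<exists>h :: 'a \<Rightarrow> L1. bounded_lattice_hom h \<and> surj h \<and>
       (\<exists>a b. h ` impl_ideal a b = impl_ideal c1 bot)) \<or>
    (\<exists>h :: 'a \<Rightarrow> L2. bounded_lattice_hom h \<and> surj h \<and>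
       (\<exists>a b. h ` impl_ideal a b = impl_ideal c2 bot)) \<or>
    (\<exists>h :: 'a \<Rightarrow> L3. bounded_lattice_hom h \<and> surj h \<and>
       (\<exists>a b. h ` impl_ideal a b = impl_ideal c3 bot))"
  (is "?N \<longleftrightarrow> ?E1 \<or> ?E2 \<or> ?E3")
proof
  assume ?N
  then obtain a b :: 'a where "\<not> (\<exists>c\<in>impl_ideal a b. \<forall>v\<in>impl_ideal a b. v \<le> c)"
    unfolding heyting_algebra_iff by blast
  from ex_homogeneous_boundary_sequence[OF assms this] obtain d x y z
    where "boundary_sequence a b d x y z" and hz: "(\<forall>m n. m \<le> n \<longrightarrow> z n \<le> z m) \<or>
     (\<forall>m n. z m \<le> z n \<longrightarrow> m = n) \<and> ((\<forall>n. x \<le> z n) \<or> (\<forall>n. \<not> x \<le> z n))" .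
  then interpret boundary_sequence a b d x y z by blast
  from hz consider "\<forall>m n. m \<le> n \<longrightarrow> z n \<le> z m"
    | "\<forall>m n. z m \<le> z n \<longrightarrow> m = n" "\<forall>n. x \<le> z n"
    | "\<forall>m n. z m \<le> z n \<longrightarrow> m = n" "\<forall>n. \<not> x \<le> z n" by blast
  then show "?E1 \<or> ?E2 \<or> ?E3"
  proof cases
    case 1
    have "\<exists>h :: 'a \<Rightarrow> L1. bounded_lattice_hom h \<and> surj h \<and> h ` impl_ideal a b = impl_ideal c1 bot"
      by (rule hom_onto_L1) (use 1 in blast)+
    then have ?E1 by (elim exE conjE) (intro exI conjI)
    then show ?thesis by (rule disjI1)
  next
    case 2
    have "\<exists>h :: 'a \<Rightarrow> L2. bounded_lattice_hom h \<and> surj h \<and> h ` impl_ideal a b = impl_ideal c2 bot"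
      by (rule hom_onto_L2) (use 2 in blast)+
    then have ?E2 by (elim exE conjE) (intro exI conjI)
    then show ?thesis by (rule disjI2[OF disjI1])
  next
    case 3
    have "\<exists>h :: 'a \<Rightarrow> L3. bounded_lattice_hom h \<and> surj h \<and> h ` impl_ideal a b = impl_ideal c3 bot"
      by (rule hom_onto_L3) (use 3 in blast)+
    then have ?E3 by (elim exE conjE) (intro exI conjI)
    then show ?thesis by (rule disjI2[OF disjI2])
  qed
next
  assume "?E1 \<or> ?E2 \<or> ?E3"
  then show ?N
  proof (elim disjE exE conjE)
    fix h :: "'a \<Rightarrow> L1" and a b
    assume "bounded_lattice_hom h" "h ` impl_ideal a b = impl_ideal c1 bot"
    then show ?N by (rule not_heyting_algebra_if_image_no_max[OF _ _ impl_ideal_c1_no_max])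
  next
    fix h :: "'a \<Rightarrow> L2" and a b
    assume "bounded_lattice_hom h" "h ` impl_ideal a b = impl_ideal c2 bot"
    then show ?N by (rule not_heyting_algebra_if_image_no_max[OF _ _ impl_ideal_c2_no_max])
  next
    fix h :: "'a \<Rightarrow> L3" and a b
    assume "bounded_lattice_hom h" "h ` impl_ideal a b = impl_ideal c3 bot"
    then show ?N by (rule not_heyting_algebra_if_image_no_max[OF _ _ impl_ideal_c3_no_max])
  qed
qed

end
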